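(* Let $\mathbb{H}$ be an elementary abelian $2$-hypergroup, the constrained direct product of $\langle q_1\rangle,\dots,\langle q_p\rangle$ with $q_1,\dots,q_p$ involutions of $\mathbb{H}$, and let $p^\sharp$ be the number of thick elements of $\mathbb{H}$ contained in $\{q_1,\dots,q_p\}$. Then the number of all closed subsets of $\mathbb{H}$ is equal to $$2^{p^\sharp}\sum_{r=0}^{p-p^\sharp}\binom{p-p^\sharp}{r}_2,$$ and the number of all strongly normal closed subsets of $\mathbb{H}$ is equal to $$\sum_{r=0}^{p-p^\sharp}\binom{p-p^\sharp}{r}_2.$$
   Context: A hypergroup is a nonempty set $\mathbb{H}$ with a hypermultiplication $(a,b)\mapsto ab\subseteq\mathbb{H}$ and a map $a\mapsto a^*$ from $\mathbb{H}$ to $\mathbb{H}$ such that, writing $\mathbb{F}\mathbb{G}=\bigcup_{b\in\mathbb{F},c\in\mathbb{G}}bc$ for $\mathbb{F},\mathbb{G}\subseteq\mathbb{H}$ and $a\mathbb{G}=\{a\}\mathbb{G}$, $\mathbb{G}a=\mathbb{G}\{a\}$: (1) $(ab)c=a(bc)$ for all $a,b,c$; (2) there is a unique $e\in\mathbb{H}$ with $ea=\{a\}=ae$ for all $a$; (3) for all $a,b,c$ the conditions $a\in bc$, $b\in ac^*$, $c\in b^*a$ are pairwise equivalent. A nonempty $\mathbb{G}\subseteq\mathbb{H}$ is a closed subset of $\mathbb{H}$ if $\mathbb{G}^*\mathbb{G}\subseteq\mathbb{G}$, where $\mathbb{G}^*=\{a^*:a\in\mathbb{G}\}$. $\langle a\rangle$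 is the intersection of all closed subsets of $\mathbb{H}$ containing $a$. An element $a$ is thin if $a^*a=\{e\}$ and thick otherwise. For closed subsets $\mathbb{F},\mathbb{G}$: $\mathbb{F}$ is normal in $\mathbb{G}$ if $\mathbb{F}\subseteq\mathbb{G}$ and $\mathbb{F}a=a\mathbb{F}$ for all $a\in\mathbb{G}$; $\mathbb{F}$ is a strongly normal closed subset of $\mathbb{G}$ if $a^*\mathbb{F}a\subseteq\mathbb{F}\subseteq\mathbb{G}$ for all $a\in\mathbb{G}$. An involution is an element $a\neq e$ such that $\{e,a\}$ is closed. Elementary abelian $2$-hypergroups: $\mathbb{H}$ is the direct product of normal closed subsets $\mathbb{G}_1,\dots,\mathbb{G}_p$ ($p\geq 1$) if, for each $i$, $\mathbb{H}=\mathbb{G}_i\widehat{\mathbb{G}_i}$ and $\mathbb{G}_i\cap\widehat{\mathbb{G}_i}=\{e\}$, where $\widehat{\mathbb{G}_i}=\prod_{j\neq i}\mathbb{G}_j$ (and $\widehat{\mathbb{G}_1}=\{e\}$ if $p=1$). Then for every $a\in\mathbb{H}$ there are unique $r_i\in\mathbb{G}_i$ ($1\le i\le p$) with $a\in r_1r_2\cdots r_p$. The direct product is constrained if $r_1r_2\cdots r_p=\{a\}$ for every $a\in\mathbb{H}$. $\mathbb{H}$ is an elementary abelian $2$-hypergroup if it is the constrained direct product of closed subsets $\langle q_1\rangle,\dots,\langle q_p\rangle$ with $q_1,\dots,q_p$ involutions of $\mathbb{H}$ (so $\langle q_i\rangle=\{e,q_i\}$). $\binom{m}{r}_2$ is the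 Gauss coefficient: the number of subgroups of $2$-rank $r$ of an elementary abelian $2$-group of $2$-rank $m$. *)

theory Defs
  imports "HOL-Algebra.Elementary_Groups" "HOL-Algebra.Product_Groups"
begin

record 'a hypergroup = "'a partial_object" +
  hmult :: "'a \<Rightarrow> 'a \<Rightarrow> 'a set"
  hstar :: "'a \<Rightarrow> 'a"

definition set_hmult :: "('a, 'b) hypergroup_scheme \<Rightarrow> 'a set \<Rightarrow> 'a set \<Rightarrow> 'a set"
  where "set_hmult H F G = (\<Union>b\<in>F. \<Union>c\<in>G. hmult H b c)"

definition is_hunit :: "('a, 'b) hypergroup_scheme \<Rightarrow> 'a \<Rightarrow> bool"
  where "is_hunit H e \<longleftrightarrow>
    e \<in> carrier H \<and> (\<forall>a\<in>carrier H. hmult H e a = {a} \<and> hmult H a e = {a})"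

definition hunit :: "('a, 'b) hypergroup_scheme \<Rightarrow> 'a"
  where "hunit H = (THE e. is_hunit H e)"

locale hypergroup =
  fixes H :: "('a, 'b) hypergroup_scheme"
  assumes nonempty: "carrier H \<noteq> {}"
    and hmult_closed: "\<lbrakk>a \<in> carrier H; b \<in> carrier H\<rbrakk> \<Longrightarrow> hmult H a b \<subseteq> carrier H"
    and hstar_closed: "a \<in> carrier H \<Longrightarrow> hstar H a \<in> carrier H"
    and hmult_assoc: "\<lbrakk>a \<in> carrier H; b \<in> carrier H; c \<in> carrier H\<rbrakk> \<Longrightarrow>
      set_hmult H (hmult H a b) {c} = set_hmult H {a} (hmult H b c)"
    and unit_unique: "\<exists>!e. is_hunit H e"
    and exchange_right: "\<lbrakk>a \<in> carrier H; b \<in> carrier H; c \<in> carrier H\<rbrakk> \<Longrightarrow>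
      a \<in> hmult H b c \<longleftrightarrow> b \<in> hmult H a (hstar H c)"
    and exchange_left: "\<lbrakk>a \<in> carrier H; b \<in> carrier H; c \<in> carrier H\<rbrakk> \<Longrightarrow>
      a \<in> hmult H b c \<longleftrightarrow> c \<in> hmult H (hstar H b) a"

definition closed_subset :: "('a, 'b) hypergroup_scheme \<Rightarrow> 'a set \<Rightarrow> bool"
  where "closed_subset H G \<longleftrightarrow>
    G \<noteq> {} \<and> G \<subseteq> carrier H \<and> set_hmult H (hstar H ` G) G \<subseteq> G"

definition hgen :: "('a, 'b) hypergroup_scheme \<Rightarrow> 'a \<Rightarrow> 'a set"
  where "hgen H a = \<Inter>{G. closed_subset H G \<and> a \<in> G}"

definition thin :: "('a, 'b) hypergroup_scheme \<Rightarrow> 'a \<Rightarrow> bool"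
  where "thin H a \<longleftrightarrow> a \<in> carrier H \<and> hmult H (hstar H a) a = {hunit H}"

definition thick :: "('a, 'b) hypergroup_scheme \<Rightarrow> 'a \<Rightarrow> bool"
  where "thick H a \<longleftrightarrow> a \<in> carrier H \<and> \<not> thin H a"

definition normal_closed :: "('a, 'b) hypergroup_scheme \<Rightarrow> 'a set \<Rightarrow> 'a set \<Rightarrow> bool"
  where "normal_closed H F G \<longleftrightarrow>
    closed_subset H F \<and> closed_subset H G \<and> F \<subseteq> G \<and>
    (\<forall>a\<in>G. set_hmult H F {a} = set_hmult H {a} F)"

definition strongly_normal_closed ::
  "('a, 'b) hypergroup_scheme \<Rightarrow> 'a set \<Rightarrow> 'a set \<Rightarrow> bool"
  where "strongly_normal_closed H F G \<longleftrightarrow>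
    closed_subset H F \<and> closed_subset H G \<and> F \<subseteq> G \<and>
    (\<forall>a\<in>G. set_hmult H (set_hmult H {hstar H a} F) {a} \<subseteq> F)"

definition involution :: "('a, 'b) hypergroup_scheme \<Rightarrow> 'a \<Rightarrow> bool"
  where "involution H a \<longleftrightarrow>
    a \<in> carrier H \<and> a \<noteq> hunit H \<and> closed_subset H {hunit H, a}"

text \<open>The empty product is \<open>{hunit H}\<close>, so \<open>hprod_omit H 1 G 1\<close> is the trivial closed subset.\<close>

definition hprod :: "('a, 'b) hypergroup_scheme \<Rightarrow> (nat \<Rightarrow> 'a set) \<Rightarrow> nat list \<Rightarrow> 'a set"
  where "hprod H G is = foldr (\<lambda>i A. set_hmult H (G i) A) is {hunit H}"

definition hprod_omit :: "('a, 'b) hypergroup_scheme \<Rightarrow> nat \<Rightarrow> (nat \<Rightarrow> 'a set) \<Rightarrow> nat \<Rightarrow> 'a set"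
  where "hprod_omit H p G i = hprod H G (filter (\<lambda>j. j \<noteq> i) [1..<Suc p])"

definition direct_product :: "('a, 'b) hypergroup_scheme \<Rightarrow> nat \<Rightarrow> (nat \<Rightarrow> 'a set) \<Rightarrow> bool"
  where "direct_product H p G \<longleftrightarrow>
    p \<ge> 1 \<and>
    (\<forall>i\<in>{1..p}. normal_closed H (G i) (carrier H) \<and>
      carrier H = set_hmult H (G i) (hprod_omit H p G i) \<and>
      G i \<inter> hprod_omit H p G i = {hunit H})"

text \<open>In a direct product every element \<open>a\<close> lies in \<open>r 1 \<cdots> r p\<close> for exactly one choice of
  components \<open>r i \<in> G i\<close>, so quantifying over all such \<open>r\<close> speaks about the components
  of \<open>a\<close>.\<close>

definition constrained_direct_product ::
  "('a, 'b) hypergroup_scheme \<Rightarrow> nat \<Rightarrow> (nat \<Rightarrow> 'a set) \<Rightarrow> bool"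
  where "constrained_direct_product H p G \<longleftrightarrow>
    direct_product H p G \<and>
    (\<forall>a\<in>carrier H. \<forall>r. (\<forall>i\<in>{1..p}. r i \<in> G i) \<and>
        a \<in> hprod H (\<lambda>i. {r i}) [1..<Suc p] \<longrightarrow>
      hprod H (\<lambda>i. {r i}) [1..<Suc p] = {a})"

definition elementary_abelian_2_hypergroup ::
  "('a, 'b) hypergroup_scheme \<Rightarrow> nat \<Rightarrow> (nat \<Rightarrow> 'a) \<Rightarrow> bool"
  where "elementary_abelian_2_hypergroup H p q \<longleftrightarrow>
    hypergroup H \<and> (\<forall>i\<in>{1..p}. involution H (q i)) \<and>
    constrained_direct_product H p (\<lambda>i. hgen H (q i))"

definition elementary_abelian_2_group :: "nat \<Rightarrow> (nat \<Rightarrow> int) monoid"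
  where "elementary_abelian_2_group m = product_group {..<m} (\<lambda>_. integer_mod_group 2)"

text \<open>The rank of an elementary abelian 2-group is its minimal number of generators.\<close>

definition subgroup_rank :: "('a, 'b) monoid_scheme \<Rightarrow> 'a set \<Rightarrow> nat"
  where "subgroup_rank G K =
    (LEAST n. \<exists>S. finite S \<and> S \<subseteq> carrier G \<and> generate G S = K \<and> card S = n)"

text \<open>All elementary abelian 2-groups of rank \<open>m\<close> are isomorphic, so it suffices to count
  subgroups in the model \<open>(\<int>/2)\<^sup>m\<close>.\<close>

definition gauss_coeff_2 :: "nat \<Rightarrow> nat \<Rightarrow> nat"
  where "gauss_coeff_2 m r =
    card {K. subgroup K (elementary_abelian_2_group m) \<and>
             subgroup_rank (elementary_abelian_2_group m) K = r}"

end

theory Submission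
  imports Defs
begin

text \<open>In \<open>H\<close> the hypermultiplication is commutative and \<open>hstar\<close> is the identity, so writing
  \<open>S\<close> for the product of the \<open>q i\<close> with \<open>i \<in> S\<close>, and \<open>B\<close> for the set of thick indices, the
  product of \<open>S\<close> and \<open>T\<close> consists of all \<open>U\<close> between the symmetric difference of \<open>S\<close> and \<open>T\<close>
  and its union with \<open>S \<inter> T \<inter> B\<close>. A closed subset containing \<open>S\<close> contains the square of \<open>S\<close>,
  hence every subset of \<open>S \<inter> B\<close>; so it splits as the power set of some \<open>T \<subseteq> B\<close> times a
  subgroup of the elementary abelian 2-group of thin elements. It is strongly normal iff
  \<open>T = B\<close>.\<close>

section \<open>Power sets under symmetric difference, and counting subgroups up to
  isomorphism\<close>

definition symdiff :: "'a set \<Rightarrow> 'a set \<Rightarrow> 'a set"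
  where "symdiff S T = (S - T) \<union> (T - S)"

text \<open>For finite \<open>A\<close> this is the elementary abelian 2-group with the singletons
  of \<open>A\<close> as a basis. Written this way, its elements are index sets, as needed for the
  thin indices.\<close>

definition symdiff_group :: "'a set \<Rightarrow> 'a set monoid"
  where "symdiff_group A = \<lparr>carrier = Pow A, mult = symdiff, one = {}\<rparr>"

lemma group_symdiff_group: "group (symdiff_group A)"
  by (rule groupI) (auto simp: symdiff_group_def symdiff_def)

text \<open>Every element is its own inverse, so closure under the operation already yields
  inverses.\<close>

lemma subgroup_symdiff_group_iff:
  "subgroup K (symdiff_group A) \<longleftrightarrow>
     K \<subseteq> Pow A \<and> {} \<in> K \<and> (\<forall>S\<in>K. \<forall>T\<in>K. symdiff S T \<in> K)"
proof
  assume "subgroup K (symdiff_group A)"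
  then interpret subgroup K "symdiff_group A" .
  show "K \<subseteq> Pow A \<and> {} \<in> K \<and> (\<forall>S\<in>K. \<forall>T\<in>K. symdiff S T \<in> K)"
    using subset one_closed m_closed by (auto simp: symdiff_group_def)
next
  assume K: "K \<subseteq> Pow A \<and> {} \<in> K \<and> (\<forall>S\<in>K. \<forall>T\<in>K. symdiff S T \<in> K)"
  interpret group "symdiff_group A" by (rule group_symdiff_group)
  show "subgroup K (symdiff_group A)"
  proof (rule subgroupI)
    fix S assume S: "S \<in> K"
    have "inv\<^bsub>symdiff_group A\<^esub> S = S"
      using K S by (intro inv_equality) (auto simp: symdiff_group_def symdiff_def)
    then show "inv\<^bsub>symdiff_group A\<^esub> S \<in> K" using S by simp
  qed (use K in \<open>auto simp: symdiff_group_def\<close>)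
qed

text \<open>Images under an isomorphism and under its inverse are again subgroups, and the two image
  maps are mutually inverse.\<close>

lemma card_subgroups_iso:
  assumes "group G" "group G'" "G \<cong> G'"
  shows "card {K. subgroup K G} = card {K. subgroup K G'}"
proof -
  obtain h where h: "h \<in> iso G G'" using assms(3) by (auto simp: is_iso_def)
  interpret G: group G by fact
  have h': "inv_into (carrier G) h \<in> iso G' G" using G.iso_set_sym[OF h] .
  have bij: "bij_betw h (carrier G) (carrier G')" using h by (auto simp: iso_def)
  have gh: "group_hom G G' h" "group_hom G' G (inv_into (carrier G) h)"
    using assms h h' by (auto simp: group_hom_def group_hom_axioms_def iso_def)
  have "bij_betw ((`) h) {K. subgroup K G} {K. subgroup K G'}"
  proof (rule bij_betw_byWitness[where f' = "(`) (inv_into (carrier G) h)"])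
    show "\<forall>K\<in>{K. subgroup K G}. inv_into (carrier G) h ` h ` K = K"
      using bij by (auto simp: bij_betw_def dest!: subgroup.subset)
    show "\<forall>K\<in>{K. subgroup K G'}. h ` inv_into (carrier G) h ` K = K"
      using bij by (simp add: bij_betw_def image_inv_into_cancel subgroup.subset)
  qed (use gh in \<open>auto intro: group_hom.subgroup_img_is_subgroup\<close>)
  then show ?thesis by (rule bij_betw_same_card)
qed

section \<open>The model of the elementary abelian 2-group, ranks of its subgroups, and Gauss
  coefficients\<close>

lemma group_elementary_abelian_2_group: "group (elementary_abelian_2_group m)"
  by (auto simp: elementary_abelian_2_group_def)

lemma carrier_elementary_abelian_2_group:
  "carrier (elementary_abelian_2_group m) = {..<m} \<rightarrow>\<^sub>E {0..<2}"
  by (auto simp: elementary_abelian_2_group_def carrier_integer_mod_group)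

lemma finite_carrier_elementary_abelian_2_group:
  "finite (carrier (elementary_abelian_2_group m))"
  unfolding carrier_elementary_abelian_2_group by (rule finite_PiE) simp_all

text \<open>A vector of zeros and ones is the characteristic function of a set, and addition modulo
  2 of such functions is symmetric difference of the sets. The enumeration \<open>h\<close> of
  \<open>A\<close> carries positions to elements.\<close>

lemma elementary_abelian_2_group_iso_symdiff_group:
  assumes "finite A" "card A = m"
  shows "elementary_abelian_2_group m \<cong> symdiff_group A"
proof -
  obtain h where h: "bij_betw h {..<m} A"
    using assms ex_bij_betw_nat_finite lessThan_atLeast0 by metis
  define \<psi> where "\<psi> f = h ` {i\<in>{..<m}. f i = (1::int)}" for f
  \<comment> \<open>The abstraction is restricted to \<open>{..<m}\<close> because elements of the
    product group are \<open>undefined\<close> elsewhere.\<close>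
  define \<phi> where "\<phi> S = (\<lambda>i\<in>{..<m}. if h i \<in> S then 1 else (0::int))" for S
  have inj: "h i = h j \<longleftrightarrow> i = j" if "i < m" "j < m" for i j
    using h that by (auto simp: bij_betw_def inj_on_def)
  have mem: "h i \<in> \<psi> f \<longleftrightarrow> f i = 1" if "i < m" for i f
    using that inj by (auto simp: \<psi>_def)
  have hA: "A = h ` {..<m}" using h by (simp add: bij_betw_def)
  have sub: "\<psi> f \<subseteq> A" for f by (auto simp: \<psi>_def hA)
  have "bij_betw \<psi> (carrier (elementary_abelian_2_group m)) (Pow A)"
  proof (rule bij_betw_byWitness[where f' = \<phi>])
    show "\<forall>f\<in>carrier (elementary_abelian_2_group m). \<phi> (\<psi> f) = f"
    proof
      fix f assume f: "f \<in> carrier (elementary_abelian_2_group m)"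
      show "\<phi> (\<psi> f) = f"
      proof
        fix i
        show "\<phi> (\<psi> f) i = f i"
        proof (cases "i < m")
          case True
          then have "f i \<in> {0..<2}"
            using f by (auto simp: carrier_elementary_abelian_2_group PiE_def Pi_def)
          then have "f i = 0 \<or> f i = 1" by auto
          then show ?thesis using True mem by (auto simp: \<phi>_def)
        next
          case False
          then show ?thesis using f
            by (auto simp: \<phi>_def carrier_elementary_abelian_2_group PiE_def extensional_def)
        qed
      qed
    qed
    show "\<forall>S\<in>Pow A. \<psi> (\<phi> S) = S"
      by (auto simp: \<psi>_def \<phi>_def hA split: if_splits)
    show "\<psi> ` carrier (elementary_abelian_2_group m) \<subseteq> Pow A" using sub by auto
    show "\<phi> ` Pow A \<subseteq> carrier (elementary_abelian_2_group m)"
      by (auto simp: \<phi>_def carrier_elementary_abelian_2_group split: if_splits)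
  qed
  moreover have "\<psi> (f \<otimes>\<^bsub>elementary_abelian_2_group m\<^esub> g) = symdiff (\<psi> f) (\<psi> g)"
    if f: "f \<in> carrier (elementary_abelian_2_group m)"
      and g: "g \<in> carrier (elementary_abelian_2_group m)" for f g
  proof -
    have pointwise: "h i \<in> \<psi> (f \<otimes>\<^bsub>elementary_abelian_2_group m\<^esub> g) \<longleftrightarrow>
        h i \<in> symdiff (\<psi> f) (\<psi> g)" if i: "i < m" for i
    proof -
      have "f i \<in> {0..<2}" "g i \<in> {0..<2}"
        using f g i by (auto simp: carrier_elementary_abelian_2_group PiE_def Pi_def)
      then have fg: "f i = 0 \<or> f i = 1" "g i = 0 \<or> g i = 1" by auto
      have "(f \<otimes>\<^bsub>elementary_abelian_2_group m\<^esub> g) i = (f i + g i) mod 2"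
        using i by (simp add: elementary_abelian_2_group_def mult_integer_mod_group)
      then show ?thesis using i fg by (auto simp: mem symdiff_def)
    qed
    have eqI: "X = Y"
      if "X \<subseteq> A" "Y \<subseteq> A" "\<And>i. i < m \<Longrightarrow> h i \<in> X \<longleftrightarrow> h i \<in> Y" for X Y
      using that unfolding hA by blast
    show ?thesis
    proof (rule eqI[OF sub _ pointwise])
      show "symdiff (\<psi> f) (\<psi> g) \<subseteq> A" using sub by (auto simp: symdiff_def)
    qed
  qed
  ultimately have "\<psi> \<in> iso (elementary_abelian_2_group m) (symdiff_group A)"
    by (auto simp: iso_def hom_def symdiff_group_def bij_betw_def)
  then show ?thesis by (auto simp: is_iso_def)
qed

text \<open>The coset of \<open>x\<close> is disjoint from the subgroup generated by
  \<open>S\<close>, has the same size, and lies with it in the larger subgroup.\<close>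

lemma (in group) generate_card_double:
  assumes "finite (carrier G)" "S \<subseteq> carrier G" "x \<in> carrier G" "x \<notin> generate G S"
  shows "2 * card (generate G S) \<le> card (generate G (insert x S))"
proof -
  let ?K = "generate G S" and ?L = "generate G (insert x S)"
  have K: "subgroup ?K G" and L: "subgroup ?L G"
    using assms by (auto intro: generate_is_subgroup)
  have sub: "?K \<subseteq> ?L" by (rule mono_generate) auto
  have x: "x \<in> ?L" by (rule generate.incl) auto
  have KG: "?K \<subseteq> carrier G" and LG: "?L \<subseteq> carrier G"
    using K L by (auto dest: subgroup.subset)
  have inj: "inj_on ((\<otimes>) x) ?K"
    using KG assms(3) by (auto simp: inj_on_def subset_iff)
  have disj: "?K \<inter> (\<otimes>) x ` ?K = {}"
  proof -
    have False if "k \<in> ?K" "x \<otimes> k \<in> ?K" for k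
    proof -
      have "(x \<otimes> k) \<otimes> inv k \<in> ?K"
        using that K by (meson subgroup.m_closed subgroup.m_inv_closed)
      then show False using that KG assms by (simp add: m_assoc subset_iff)
    qed
    then show ?thesis by auto
  qed
  have fin: "finite ?K" "finite ?L" using KG LG assms(1) by (auto intro: finite_subset)
  have "2 * card ?K = card (?K \<union> (\<otimes>) x ` ?K)"
    using fin disj inj by (simp add: card_Un_disjoint card_image)
  also have "\<dots> \<le> card ?L"
    using fin sub x L by (intro card_mono) (auto intro: subgroup.m_closed)
  finally show ?thesis .
qed

text \<open>Among the subsets \<open>S\<close> of \<open>K\<close> that generate at least
  \<open>2 ^ card S\<close> elements, one of greatest cardinality must generate \<open>K\<close>: a
  missing element could be added to it, doubling the generated subgroup at least.\<close>

lemma (in group) subgroup_ex_small_generating_set: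
  assumes "finite (carrier G)" "subgroup K G"
  shows "\<exists>S\<subseteq>K. generate G S = K \<and> 2 ^ card S \<le> card K"
proof -
  let ?P = "\<lambda>S. S \<subseteq> K \<and> 2 ^ card S \<le> card (generate G S)"
  have KG: "K \<subseteq> carrier G" using assms(2) by (rule subgroup.subset)
  have finK: "finite K" using KG assms(1) by (rule finite_subset)
  have "?P {}" by (simp add: generate_empty)
  \<comment> \<open>The empty set starts the search, as it generates one element; the cardinalities
    are bounded because \<open>K\<close> is finite.\<close>
  then obtain S where S: "?P S" and max: "\<And>T. ?P T \<Longrightarrow> card T \<le> card S"
    using ex_has_greatest_nat[of ?P "{}" card "Suc (card K)"] card_mono[OF finK]
    by (metis less_Suc_eq_le)
  have gen: "generate G S \<subseteq> K"
    using S assms(2) generate_subgroup_incl by blast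
  have "generate G S = K"
  proof (rule ccontr)
    assume "generate G S \<noteq> K"
    then obtain x where x: "x \<in> K" "x \<notin> generate G S" using gen by blast
    then have "x \<notin> S" by (auto intro: generate.incl)
    moreover have "finite S" using S finK finite_subset by blast
    ultimately have c: "card (insert x S) = Suc (card S)" by simp
    have "2 * card (generate G S) \<le> card (generate G (insert x S))"
      using S x KG assms(1) by (intro generate_card_double) auto
    then have "?P (insert x S)" using S x c by auto
    then have "card (insert x S) \<le> card S" by (rule max)
    then show False using c by simp
  qed
  then show ?thesis using S by auto
qed

text \<open>The whole group has \<open>2 ^ m\<close> elements, so the small generating set of the
  preceding lemma has at most \<open>m\<close> of them. The rank, being a least cardinality, is no
  larger.\<close>

lemma subgroup_rank_elementary_abelian_2_group_le:
  assumes "subgroup K (elementary_abelian_2_group m)"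
  shows "subgroup_rank (elementary_abelian_2_group m) K \<le> m"
proof -
  let ?G = "elementary_abelian_2_group m"
  interpret group ?G by (rule group_elementary_abelian_2_group)
  note fin = finite_carrier_elementary_abelian_2_group[of m]
  have card: "card (carrier ?G) = 2 ^ m"
    by (simp add: carrier_elementary_abelian_2_group card_PiE)
  obtain S where S: "S \<subseteq> K" "generate ?G S = K" "2 ^ card S \<le> card K"
    using subgroup_ex_small_generating_set[OF fin assms] by blast
  have KG: "K \<subseteq> carrier ?G" using assms by (rule subgroup.subset)
  have "card K \<le> 2 ^ m" using card_mono[OF fin KG] card by simp
  then have "(2::nat) ^ card S \<le> 2 ^ m" using S(3) by linarith
  then have "card S \<le> m" by simp
  moreover have "subgroup_rank ?G K \<le> card S"
    unfolding subgroup_rank_def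
  proof (rule Least_le, intro exI conjI)
    show "S \<subseteq> carrier ?G" using S(1) KG by (rule subset_trans)
    then show "finite S" using fin by (rule finite_subset)
  qed (use S(2) in simp_all)
  ultimately show ?thesis by simp
qed

text \<open>The subgroups are partitioned by their rank, and the bound on the rank ensures that the
  range of summation misses none.\<close>

lemma sum_gauss_coeff_2:
  "(\<Sum>r=0..m. gauss_coeff_2 m r) = card {K. subgroup K (elementary_abelian_2_group m)}"
proof -
  let ?G = "elementary_abelian_2_group m"
  have fin: "finite {K. subgroup K ?G}"
  proof (rule finite_subset)
    show "{K. subgroup K ?G} \<subseteq> Pow (carrier ?G)" 
      by (simp add: subset_iff subgroup.mem_carrier)
    show "finite (Pow (carrier ?G))"
      using finite_carrier_elementary_abelian_2_group by simp
  qed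
  have "{K. subgroup K ?G} = (\<Union>r\<in>{0..m}. {K. subgroup K ?G \<and> subgroup_rank ?G K = r})"
    using subgroup_rank_elementary_abelian_2_group_le by fastforce
  then have "card {K. subgroup K ?G} =
      card (\<Union>r\<in>{0..m}. {K. subgroup K ?G \<and> subgroup_rank ?G K = r})" by simp
  also have "\<dots> = (\<Sum>r=0..m. gauss_coeff_2 m r)"
    unfolding gauss_coeff_2_def
    by (subst card_UN_disjoint) (auto intro: finite_subset[OF _ fin])
  finally show ?thesis by simp
qed

lemma card_subgroups_symdiff_group:
  assumes "finite A"
  shows "card {K. subgroup K (symdiff_group A)} = (\<Sum>r=0..card A. gauss_coeff_2 (card A) r)"
  unfolding sum_gauss_coeff_2
  using card_subgroups_iso[OF group_elementary_abelian_2_group group_symdiff_group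
      elementary_abelian_2_group_iso_symdiff_group[OF assms refl]] by simp

section \<open>Families of index sets that model closed subsets, and their classification\<close>

definition closed_family :: "'a set \<Rightarrow> 'a set set \<Rightarrow> bool"
  where "closed_family B \<Phi> \<longleftrightarrow> \<Phi> \<noteq> {} \<and>
    (\<forall>S\<in>\<Phi>. \<forall>T\<in>\<Phi>. \<forall>U. symdiff S T \<subseteq> U \<and> U \<subseteq> symdiff S T \<union> (S \<inter> T \<inter> B) \<longrightarrow> U \<in> \<Phi>)"

text \<open>For \<open>T\<close> contained in \<open>B\<close>, this is the power set of
  \<open>T\<close> times \<open>K\<close>: inside \<open>B\<close> any subset of \<open>T\<close>
  may occur, and outside \<open>B\<close> the trace must belong to \<open>K\<close>.\<close>

definition box_family :: "'a set \<Rightarrow> 'a set \<Rightarrow> 'a set \<times> 'a set set \<Rightarrow> 'a set set"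
  where "box_family N B = (\<lambda>(T, K). {S. S \<subseteq> N \<and> S \<inter> B \<subseteq> T \<and> S - B \<in> K})"

lemma closed_familyD:
  assumes "closed_family B \<Phi>" "S \<in> \<Phi>" "T \<in> \<Phi>"
    "symdiff S T \<subseteq> U" "U \<subseteq> symdiff S T \<union> (S \<inter> T \<inter> B)"
  shows "U \<in> \<Phi>"
  using assms unfolding closed_family_def by blast

text \<open>The symmetric difference is the smallest set in the product of \<open>S\<close> and
  \<open>T\<close>.\<close>

lemma closed_family_symdiff:
  assumes "closed_family B \<Phi>" "S \<in> \<Phi>" "T \<in> \<Phi>"
  shows "symdiff S T \<in> \<Phi>"
  using assms by (rule closed_familyD) auto

text \<open>These sets are exactly the product of \<open>S\<close> with itself, since the symmetric
  difference of \<open>S\<close> with \<open>S\<close> is empty.\<close>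

lemma closed_family_subset:
  assumes "closed_family B \<Phi>" "S \<in> \<Phi>" "U \<subseteq> S \<inter> B"
  shows "U \<in> \<Phi>"
  using assms(1,2,2) by (rule closed_familyD) (use assms(3) in \<open>auto simp: symdiff_def\<close>)

lemma closed_family_empty:
  assumes "closed_family B \<Phi>"
  shows "{} \<in> \<Phi>"
  using assms closed_family_subset[OF assms] unfolding closed_family_def by blast

text \<open>An index of \<open>B\<close> occurring in a member yields its singleton as a member. The
  finite set \<open>W\<close> is then assembled from singletons by disjoint symmetric
  differences.\<close>

lemma closed_family_Union:
  assumes "closed_family B \<Phi>" "finite W" "W \<subseteq> \<Union>\<Phi> \<inter> B"
  shows "W \<in> \<Phi>"
  using assms(2,3)
proof (induction W)
  case empty
  show ?case by (rule closed_family_empty[OF assms(1)])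
next
  case (insert b W)
  then obtain S where "S \<in> \<Phi>" "b \<in> S" by blast
  then have "{b} \<in> \<Phi>" using closed_family_subset[OF assms(1), of S "{b}"] insert by auto
  moreover have "W \<in> \<Phi>" using insert by auto
  ultimately have "symdiff {b} W \<in> \<Phi>" by (rule closed_family_symdiff[OF assms(1)])
  moreover have "symdiff {b} W = insert b W" using insert by (auto simp: symdiff_def)
  ultimately show ?case by simp
qed

text \<open>The inverse records the indices of \<open>B\<close> that occur in the family and the
  members that avoid \<open>B\<close>. Nothing is lost, since \<open>S\<close> is a member exactly
  if both \<open>S \<inter> B\<close> and \<open>S - B\<close> are.\<close>

lemma bij_betw_box_family:
  assumes "finite N" "B \<subseteq> N"
  shows "bij_betw (box_family N B) (Pow B \<times> {K. subgroup K (symdiff_group (N - B))})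
     {\<Phi>. \<Phi> \<subseteq> Pow N \<and> closed_family B \<Phi>}"
proof (rule bij_betw_byWitness[where f' = "\<lambda>\<Phi>. (\<Union>\<Phi> \<inter> B, {S\<in>\<Phi>. S \<subseteq> N - B})"])
  show "\<forall>x\<in>Pow B \<times> {K. subgroup K (symdiff_group (N - B))}.
      (\<Union>(box_family N B x) \<inter> B, {S \<in> box_family N B x. S \<subseteq> N - B}) = x"
  proof (intro ballI, elim SigmaE)
    fix x T K assume "T \<in> Pow B" "K \<in> {K. subgroup K (symdiff_group (N - B))}" and x: "x = (T, K)"
    then have T: "T \<subseteq> B" and K: "subgroup K (symdiff_group (N - B))" by auto
    have K': "K \<subseteq> Pow (N - B)" "{} \<in> K" using K by (auto simp: subgroup_symdiff_group_iff)
    \<comment> \<open>The set \<open>T\<close> itself lies in the box, so the union of the box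
      contains all of \<open>T\<close>.\<close>
    have "T - B = {}" using T by blast
    then have "T - B \<in> K" using K'(2) by (simp only:)
    then have "T \<in> box_family N B (T, K)" using T assms(2) by (auto simp: box_family_def)
    then have "\<Union>(box_family N B (T, K)) \<inter> B = T" using T by (auto simp: box_family_def)
    moreover have "{S \<in> box_family N B (T, K). S \<subseteq> N - B} = K"
    proof -
      have "S \<in> box_family N B (T, K) \<and> S \<subseteq> N - B \<longleftrightarrow> S \<in> K" for S
      proof (cases "S \<subseteq> N - B")
        case True
        then have "S - B = S" "S \<inter> B = {}" by auto
        then show ?thesis using True by (auto simp: box_family_def)
      next
        case False
        then show ?thesis using K'(1) by blast
      qed
      then show ?thesis by simp
    qed
    ultimately show "(\<Union>(box_family N B x) \<inter> B,
      {S \<in> box_family N B x. S \<subseteq> N - B}) = x" by (simp add: x)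
  qed
  show "\<forall>\<Phi>\<in>{\<Phi>. \<Phi> \<subseteq> Pow N \<and> closed_family B \<Phi>}.
      box_family N B (\<Union>\<Phi> \<inter> B, {S \<in> \<Phi>. S \<subseteq> N - B}) = \<Phi>"
  proof
    fix \<Phi> assume "\<Phi> \<in> {\<Phi>. \<Phi> \<subseteq> Pow N \<and> closed_family B \<Phi>}"
    then have sub: "\<Phi> \<subseteq> Pow N" and cl: "closed_family B \<Phi>" by simp_all
    have "S \<in> \<Phi> \<longleftrightarrow> S \<in> box_family N B (\<Union>\<Phi> \<inter> B, {S \<in> \<Phi>. S \<subseteq> N - B})" for S
    proof
      assume S: "S \<in> \<Phi>"
      \<comment> \<open>The trace of \<open>S\<close> on \<open>B\<close> is a member, and the
        symmetric difference with it cuts \<open>S\<close> down to its part outside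
        \<open>B\<close>.\<close>
      then have "symdiff S (S \<inter> B) \<in> \<Phi>"
        using cl closed_family_subset closed_family_symdiff by blast
      moreover have "symdiff S (S \<inter> B) = S - B" by (auto simp: symdiff_def)
      ultimately show "S \<in> box_family N B (\<Union>\<Phi> \<inter> B, {S \<in> \<Phi>. S \<subseteq> N - B})"
        using S sub by (auto simp: box_family_def)
    next
      assume S: "S \<in> box_family N B (\<Union>\<Phi> \<inter> B, {S \<in> \<Phi>. S \<subseteq> N - B})"
      then have "S \<inter> B \<in> \<Phi>"
        using assms finite_subset
        by (intro closed_family_Union[OF cl]) (auto simp: box_family_def)
      moreover have "S - B \<in> \<Phi>" using S by (simp add: box_family_def)
      ultimately have "symdiff (S \<inter> B) (S - B) \<in> \<Phi>" by (rule closed_family_symdiff[OF cl])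
      moreover have "symdiff (S \<inter> B) (S - B) = S" by (auto simp: symdiff_def)
      ultimately show "S \<in> \<Phi>" by simp
    qed
    then show "box_family N B (\<Union>\<Phi> \<inter> B, {S \<in> \<Phi>. S \<subseteq> N - B}) = \<Phi>" by blast
  qed
  show "box_family N B ` (Pow B \<times> {K. subgroup K (symdiff_group (N - B))})
      \<subseteq> {\<Phi>. \<Phi> \<subseteq> Pow N \<and> closed_family B \<Phi>}"
  proof (rule image_subsetI, elim SigmaE)
    fix x T K assume "T \<in> Pow B" "K \<in> {K. subgroup K (symdiff_group (N - B))}" and x: "x = (T, K)"
    then have T: "T \<subseteq> B" and K: "subgroup K (symdiff_group (N - B))" by auto
    have K': "K \<subseteq> Pow (N - B)" "{} \<in> K" "\<And>S T. S \<in> K \<Longrightarrow> T \<in> K \<Longrightarrow> symdiff S T \<in> K"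
      using K by (auto simp: subgroup_symdiff_group_iff)
    have "{} \<in> box_family N B (T, K)" using K' by (auto simp: box_family_def)
    moreover have "W \<in> box_family N B (T, K)"
      if "U \<in> box_family N B (T, K)" "V \<in> box_family N B (T, K)"
        and W: "symdiff U V \<subseteq> W" "W \<subseteq> symdiff U V \<union> (U \<inter> V \<inter> B)" for U V W
    proof -
      \<comment> \<open>The freedom in the product concerns indices of \<open>B\<close> only;
        outside \<open>B\<close> the set \<open>W\<close> is determined.\<close>
      have "W - B = symdiff (U - B) (V - B)" using W by (auto simp: symdiff_def)
      moreover have "symdiff (U - B) (V - B) \<in> K" using that K' by (auto simp: box_family_def)
      moreover have "W \<subseteq> U \<union> V" using W by (auto simp: symdiff_def)
      ultimately show ?thesis using that by (auto simp: box_family_def)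
    qed
    ultimately have "closed_family B (box_family N B (T, K))"
      unfolding closed_family_def by blast
    then show "box_family N B x \<in> {\<Phi>. \<Phi> \<subseteq> Pow N \<and> closed_family B \<Phi>}"
      by (auto simp: x box_family_def)
  qed
  show "(\<lambda>\<Phi>. (\<Union>\<Phi> \<inter> B, {S \<in> \<Phi>. S \<subseteq> N - B})) ` {\<Phi>. \<Phi> \<subseteq> Pow N \<and> closed_family B \<Phi>}
      \<subseteq> Pow B \<times> {K. subgroup K (symdiff_group (N - B))}"
    using closed_family_empty closed_family_symdiff
    by (auto simp: subgroup_symdiff_group_iff) (auto simp: symdiff_def)
qed

lemma card_closed_families:
  assumes "finite N" "B \<subseteq> N"
  shows "card {\<Phi>. \<Phi> \<subseteq> Pow N \<and> closed_family B \<Phi>} =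
    2 ^ card B * (\<Sum>r=0..card (N - B). gauss_coeff_2 (card (N - B)) r)"
proof -
  have "finite B" using assms finite_subset by blast
  then show ?thesis
    using bij_betw_same_card[OF bij_betw_box_family[OF assms]] assms
    by (simp add: card_cartesian_product card_Pow card_subgroups_symdiff_group)
qed

text \<open>A box contains \<open>B\<close> exactly if its first parameter is \<open>B\<close>. Only
  the subgroup remains to be chosen, and the factor \<open>2 ^ card B\<close> disappears.\<close>

lemma card_closed_families_containing:
  assumes "finite N" "B \<subseteq> N"
  shows "card {\<Phi>. \<Phi> \<subseteq> Pow N \<and> closed_family B \<Phi> \<and> B \<in> \<Phi>} =
    (\<Sum>r=0..card (N - B). gauss_coeff_2 (card (N - B)) r)"
proof -
  let ?K = "{K. subgroup K (symdiff_group (N - B))}"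
  have bij: "bij_betw (box_family N B) (Pow B \<times> ?K) {\<Phi>. \<Phi> \<subseteq> Pow N \<and> closed_family B \<Phi>}"
    by (rule bij_betw_box_family[OF assms])
  have mem: "B \<in> box_family N B (T, K) \<longleftrightarrow> T = B" if "T \<subseteq> B" "K \<in> ?K" for T K
    using that assms by (auto simp: box_family_def subgroup_symdiff_group_iff)
  have "box_family N B ` ({B} \<times> ?K) = {\<Phi>. \<Phi> \<subseteq> Pow N \<and> closed_family B \<Phi> \<and> B \<in> \<Phi>}"
  proof -
    have "{\<Phi>. \<Phi> \<subseteq> Pow N \<and> closed_family B \<Phi> \<and> B \<in> \<Phi>} =
        {\<Phi> \<in> box_family N B ` (Pow B \<times> ?K). B \<in> \<Phi>}"
      using bij by (auto simp: bij_betw_def)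
    also have "\<dots> = box_family N B ` {x \<in> Pow B \<times> ?K. B \<in> box_family N B x}" by blast
    also have "{x \<in> Pow B \<times> ?K. B \<in> box_family N B x} = {B} \<times> ?K"
      using mem by auto
    finally show ?thesis ..
  qed
  moreover have "card (box_family N B ` ({B} \<times> ?K)) = card ({B} \<times> ?K)"
    using bij_betw_imp_inj_on[OF bij] by (intro card_image) (rule inj_on_subset, auto)
  ultimately have "card {\<Phi>. \<Phi> \<subseteq> Pow N \<and> closed_family B \<Phi> \<and> B \<in> \<Phi>} = card ({B} \<times> ?K)"
    by simp
  then show ?thesis using assms
    by (simp add: card_cartesian_product card_subgroups_symdiff_group)
qed

section \<open>Products of sets and of lists of sets\<close>

lemma set_hmult_mono:
  "F \<subseteq> F' \<Longrightarrow> G \<subseteq> G' \<Longrightarrow> set_hmult H F G \<subseteq> set_hmult H F' G'"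
  by (auto simp: set_hmult_def)

lemma set_hmult_singleton [simp]: "set_hmult H {a} {b} = hmult H a b"
  by (simp add: set_hmult_def)

lemma hprod_Nil [simp]: "hprod H G [] = {hunit H}"
  by (simp add: hprod_def)

lemma hprod_Cons [simp]: "hprod H G (i # is) = set_hmult H (G i) (hprod H G is)"
  by (simp add: hprod_def)

lemma hprod_mono:
  "(\<And>i. i \<in> set is \<Longrightarrow> F i \<subseteq> G i) \<Longrightarrow> hprod H F is \<subseteq> hprod H G is"
  by (induction "is") (simp_all add: set_hmult_mono)

lemma hprod_cong:
  "(\<And>i. i \<in> set is \<Longrightarrow> F i = G i) \<Longrightarrow> hprod H F is = hprod H G is"
  by (induction "is") auto

text \<open>An element of a product of sets already lies in a product of chosen elements. The list
  is distinct so that one function \<open>r\<close> can record an independent choice at each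
  position.\<close>

lemma mem_hprod_iff:
  "distinct is \<Longrightarrow>
     x \<in> hprod H G is \<longleftrightarrow> (\<exists>r. (\<forall>i\<in>set is. r i \<in> G i) \<and> x \<in> hprod H (\<lambda>i. {r i}) is)"
proof (induction "is" arbitrary: x)
  case Nil
  then show ?case by simp
next
  case (Cons i "is")
  show ?case
  proof
    assume "x \<in> hprod H G (i # is)"
    then obtain b c where b: "b \<in> G i" and c: "c \<in> hprod H G is" and x: "x \<in> hmult H b c"
      by (auto simp: set_hmult_def)
    obtain r where r: "\<forall>i\<in>set is. r i \<in> G i" "c \<in> hprod H (\<lambda>i. {r i}) is"
      using Cons c by auto
    have "hprod H (\<lambda>j. {(r(i := b)) j}) is = hprod H (\<lambda>i. {r i}) is"
      using Cons.prems by (intro hprod_cong) auto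
    then have "x \<in> hprod H (\<lambda>j. {(r(i := b)) j}) (i # is)"
      using r x by (auto simp: set_hmult_def)
    moreover have "\<forall>j\<in>set (i # is). (r(i := b)) j \<in> G j" using r b by auto
    ultimately show "\<exists>r. (\<forall>i\<in>set (i # is). r i \<in> G i) \<and> x \<in> hprod H (\<lambda>i. {r i}) (i # is)"
      by blast
  next
    assume "\<exists>r. (\<forall>i\<in>set (i # is). r i \<in> G i) \<and> x \<in> hprod H (\<lambda>i. {r i}) (i # is)"
    then obtain r where "\<forall>i\<in>set (i # is). r i \<in> G i" "x \<in> hprod H (\<lambda>i. {r i}) (i # is)"
      by blast
    then show "x \<in> hprod H G (i # is)"
      using hprod_mono[of "i # is" "\<lambda>i. {r i}" G H] by blast
  qed
qed

section \<open>Consequences of the hypergroup axioms\<close>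

context hypergroup
begin

lemma is_hunit_hunit: "is_hunit H (hunit H)"
  unfolding hunit_def by (rule theI'[OF unit_unique])

lemma hunit_closed: "hunit H \<in> carrier H"
  using is_hunit_hunit by (simp add: is_hunit_def)

lemma hmult_hunit [simp]:
  assumes "a \<in> carrier H"
  shows "hmult H (hunit H) a = {a}" "hmult H a (hunit H) = {a}"
  using is_hunit_hunit assms by (auto simp: is_hunit_def)

lemma set_hmult_hunit [simp]:
  assumes "F \<subseteq> carrier H"
  shows "set_hmult H {hunit H} F = F" "set_hmult H F {hunit H} = F"
proof -
  have "set_hmult H {hunit H} F = (\<Union>a\<in>F. {a})" "set_hmult H F {hunit H} = (\<Union>a\<in>F. {a})"
    unfolding set_hmult_def using assms by (auto simp: subset_iff)
  then show "set_hmult H {hunit H} F = F" "set_hmult H F {hunit H} = F" by auto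
qed

lemma set_hmult_closed:
  assumes "F \<subseteq> carrier H" "G \<subseteq> carrier H"
  shows "set_hmult H F G \<subseteq> carrier H"
  using assms hmult_closed by (fastforce simp: set_hmult_def)

lemma set_hmult_assoc:
  assumes "F \<subseteq> carrier H" "G \<subseteq> carrier H" "K \<subseteq> carrier H"
  shows "set_hmult H (set_hmult H F G) K = set_hmult H F (set_hmult H G K)"
proof -
  have "set_hmult H (set_hmult H F G) K =
      (\<Union>a\<in>F. \<Union>b\<in>G. \<Union>c\<in>K. set_hmult H (hmult H a b) {c})"
    by (auto simp: set_hmult_def)
  also have "\<dots> = (\<Union>a\<in>F. \<Union>b\<in>G. \<Union>c\<in>K. set_hmult H {a} (hmult H b c))"
    using assms by (intro SUP_cong refl hmult_assoc) auto
  also have "\<dots> = set_hmult H F (set_hmult H G K)"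
    by (auto simp: set_hmult_def)
  finally show ?thesis .
qed

text \<open>Exchange turns membership of \<open>a\<close> in its product with the unit into the
  claim.\<close>

lemma hunit_mem_hstar_hmult:
  "a \<in> carrier H \<Longrightarrow> hunit H \<in> hmult H (hstar H a) a"
  using exchange_left[of a a "hunit H"] hunit_closed by simp

text \<open>Multiply by \<open>hstar H a\<close> on the left and reassociate: an empty product would
  stay empty, yet the result contains \<open>b\<close>, because the product of
  \<open>hstar H a\<close> and \<open>a\<close> contains the unit.\<close>

lemma hmult_nonempty:
  assumes "a \<in> carrier H" "b \<in> carrier H"
  shows "hmult H a b \<noteq> {}"
proof
  assume "hmult H a b = {}"
  then have "set_hmult H (hmult H (hstar H a) a) {b} = {}"
    using hmult_assoc[of "hstar H a" a b] assms hstar_closed by (simp add: set_hmult_def)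
  moreover have "b \<in> set_hmult H (hmult H (hstar H a) a) {b}"
    using hunit_mem_hstar_hmult[OF assms(1)] assms(2) by (force simp: set_hmult_def)
  ultimately show False by simp
qed

lemma hprod_closed:
  "(\<And>i. i \<in> set is \<Longrightarrow> G i \<subseteq> carrier H) \<Longrightarrow> hprod H G is \<subseteq> carrier H"
  by (induction "is") (simp_all add: hunit_closed set_hmult_closed)

lemma hprod_nonempty:
  assumes "\<And>i. i \<in> set is \<Longrightarrow> G i \<subseteq> carrier H \<and> G i \<noteq> {}"
  shows "hprod H G is \<noteq> {}"
  using assms
proof (induction "is")
  case (Cons i "is")
  then have "hprod H G is \<noteq> {}" "hprod H G is \<subseteq> carrier H" "G i \<noteq> {}" "G i \<subseteq> carrier H"
    using hprod_closed[of "is" G] by auto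
  then obtain a b where "a \<in> G i" "b \<in> hprod H G is" "a \<in> carrier H" "b \<in> carrier H" by blast
  then show ?case using hmult_nonempty[of a b] by (auto simp: set_hmult_def)
qed simp

lemma hunit_mem_hprod:
  assumes "\<And>i. i \<in> set is \<Longrightarrow> hunit H \<in> G i"
  shows "hunit H \<in> hprod H G is"
  using assms
proof (induction "is")
  case (Cons i "is")
  then have "hunit H \<in> G i" "hunit H \<in> hprod H G is" by auto
  then show ?case using hunit_closed by (force simp: set_hmult_def)
qed simp

lemma factor_subset_hprod:
  assumes "\<And>i. i \<in> set is \<Longrightarrow> hunit H \<in> G i \<and> G i \<subseteq> carrier H" "j \<in> set is"
  shows "G j \<subseteq> hprod H G is"
  using assms
proof (induction "is")
  case (Cons i "is")
  show ?case
  proof (cases "j = i")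
    case True
    have "set_hmult H (G i) {hunit H} \<subseteq> hprod H G (i # is)"
      unfolding hprod_Cons True using Cons.prems hunit_mem_hprod[of "is" G]
      by (intro set_hmult_mono) auto
    then show ?thesis using Cons.prems True by simp
  next
    case False
    then have j: "G j \<subseteq> hprod H G is" using Cons by auto
    have "set_hmult H {hunit H} (G j) \<subseteq> hprod H G (i # is)"
      unfolding hprod_Cons using Cons.prems j by (intro set_hmult_mono) auto
    then show ?thesis using Cons.prems by simp
  qed
qed simp

lemma set_hmult_hprod_commute:
  assumes "F \<subseteq> carrier H"
    and "\<And>i. i \<in> set is \<Longrightarrow> G i \<subseteq> carrier H \<and> set_hmult H F (G i) = set_hmult H (G i) F"
  shows "set_hmult H F (hprod H G is) = set_hmult H (hprod H G is) F"
  using assms(2)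
proof (induction "is")
  case Nil
  then show ?case using assms(1) by simp
next
  case (Cons i "is")
  have c: "G i \<subseteq> carrier H" "hprod H G is \<subseteq> carrier H"
    using Cons.prems hprod_closed[of "is" G] by auto
  have "set_hmult H F (hprod H G (i # is)) = set_hmult H (set_hmult H F (G i)) (hprod H G is)"
    using assms c by (simp add: set_hmult_assoc)
  also have "\<dots> = set_hmult H (G i) (set_hmult H F (hprod H G is))"
    using Cons.prems assms c by (simp add: set_hmult_assoc)
  also have "\<dots> = set_hmult H (hprod H G (i # is)) F"
    using Cons assms c by (simp add: set_hmult_assoc)
  finally show ?case .
qed

lemma hunit_mem_closed_subset:
  assumes "closed_subset H G"
  shows "hunit H \<in> G"
proof -
  obtain a where "a \<in> G" "a \<in> carrier H" using assms by (auto simp: closed_subset_def)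
  then show ?thesis using assms hunit_mem_hstar_hmult[of a]
    by (auto simp: closed_subset_def set_hmult_def)
qed

lemma hgen_involution:
  assumes "involution H a"
  shows "hgen H a = {hunit H, a}"
  using assms hunit_mem_closed_subset by (auto simp: hgen_def involution_def)

text \<open>Closedness leaves only the unit and \<open>a\<close> as values of
  \<open>hstar H a\<close>. If it were the unit, then the unit would lie in the product
  \<open>{a}\<close> of the unit and \<open>a\<close>, although \<open>a\<close> differs from
  it.\<close>

lemma hstar_involution:
  assumes "involution H a"
  shows "hstar H a = a"
proof -
  have a: "a \<in> carrier H" "a \<noteq> hunit H" "closed_subset H {hunit H, a}"
    using assms by (auto simp: involution_def)
  have "hmult H (hstar H a) (hunit H) \<subseteq> {hunit H, a}"
    using a(3) by (auto simp: closed_subset_def set_hmult_def)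
  then have "hstar H a \<in> {hunit H, a}" using a hstar_closed by auto
  moreover have "hstar H a \<noteq> hunit H"
    using hunit_mem_hstar_hmult[of a] a by auto
  ultimately show ?thesis by simp
qed

text \<open>As \<open>a\<close> is its own star, its square lies in \<open>{hunit H, a}\<close> and
  contains the unit. Thickness decides whether \<open>a\<close> occurs as well.\<close>

lemma hmult_involution:
  assumes "involution H a"
  shows "hmult H a a = (if thick H a then {hunit H, a} else {hunit H})"
proof -
  have a: "a \<in> carrier H" "closed_subset H {hunit H, a}"
    using assms by (auto simp: involution_def)
  have "hmult H a a \<subseteq> {hunit H, a}"
    using a hstar_involution[OF assms] by (auto simp: closed_subset_def set_hmult_def)
  moreover have "hunit H \<in> hmult H a a"
    using hunit_mem_hstar_hmult[of a] a hstar_involution[OF assms] by simp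
  moreover have "thick H a \<longleftrightarrow> hmult H a a \<noteq> {hunit H}"
    using a hstar_involution[OF assms] by (simp add: thick_def thin_def)
  ultimately show ?thesis by auto
qed

end

section \<open>Coordinates in an elementary abelian 2-hypergroup\<close>

locale elementary_abelian_2 = hypergroup H
  for H :: "('a, 'b) hypergroup_scheme" +
  fixes p :: nat and q :: "nat \<Rightarrow> 'a"
  assumes elementary_abelian: "elementary_abelian_2_hypergroup H p q"
begin

declare upt_Suc [simp del]

definition thick_indices :: "nat set"
  where "thick_indices = {i\<in>{1..p}. thick H (q i)}"

definition component :: "nat set \<Rightarrow> nat \<Rightarrow> 'a"
  where "component S i = (if i \<in> S then q i else hunit H)"

text \<open>The use of \<open>the_elem\<close> is justified by \<open>hprod_component\<close>:
  constrainedness makes the product a singleton.\<close>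

definition element :: "nat set \<Rightarrow> 'a"
  where "element S = the_elem (hprod H (\<lambda>i. {component S i}) [1..<Suc p])"

lemma involution_q: "i \<in> {1..p} \<Longrightarrow> involution H (q i)"
  using elementary_abelian by (auto simp: elementary_abelian_2_hypergroup_def)

lemma q_closed: "i \<in> {1..p} \<Longrightarrow> q i \<in> carrier H"
  using involution_q by (auto simp: involution_def)

lemma q_neq_hunit: "i \<in> {1..p} \<Longrightarrow> q i \<noteq> hunit H"
  using involution_q by (auto simp: involution_def)

lemma hgen_q: "i \<in> {1..p} \<Longrightarrow> hgen H (q i) = {hunit H, q i}"
  using involution_q hgen_involution by auto

lemma component_closed: "i \<in> {1..p} \<Longrightarrow> component S i \<in> carrier H"
  using q_closed hunit_closed by (simp add: component_def)

lemma hprod_omit_hgen: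
  assumes "i \<in> {1..p}"
  shows "hgen H (q i) \<inter> hprod_omit H p (\<lambda>i. hgen H (q i)) i = {hunit H}"
    and "carrier H = set_hmult H (hgen H (q i)) (hprod_omit H p (\<lambda>i. hgen H (q i)) i)"
    and "normal_closed H (hgen H (q i)) (carrier H)"
  using elementary_abelian assms
  unfolding elementary_abelian_2_hypergroup_def constrained_direct_product_def direct_product_def
  by blast+

lemma q_not_mem_hprod_omit:
  assumes "i \<in> {1..p}"
  shows "q i \<notin> hprod_omit H p (\<lambda>i. hgen H (q i)) i"
  using hprod_omit_hgen(1)[OF assms] hgen_q[OF assms] q_neq_hunit[OF assms] by blast

text \<open>If two indices shared a value, then \<open>q i\<close> would lie in the factor of
  \<open>j\<close>, hence in the product of the factors other than that of \<open>i\<close>.\<close>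

lemma inj_on_q: "inj_on q {1..p}"
proof (rule inj_onI, rule ccontr)
  fix i j assume ij: "i \<in> {1..p}" "j \<in> {1..p}" "q i = q j" "i \<noteq> j"
  have "hgen H (q j) \<subseteq> hprod_omit H p (\<lambda>i. hgen H (q i)) i"
    unfolding hprod_omit_def
    using ij q_closed hunit_closed
    by (intro factor_subset_hprod[where G = "\<lambda>i. hgen H (q i)"]) (auto simp: hgen_q)
  then show False using q_not_mem_hprod_omit[of i] ij by (auto simp: hgen_q)
qed

text \<open>Normality of the factor of \<open>j\<close> gives equality only after \<open>q i\<close>
  is added to both products. For distinct indices, exchange shows that \<open>q i\<close> lies in
  neither: otherwise \<open>q j\<close> would lie in the square of \<open>q i\<close>.\<close>

lemma hmult_q_commute:
  assumes "i \<in> {1..p}" "j \<in> {1..p}"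
  shows "hmult H (q i) (q j) = hmult H (q j) (q i)"
proof (cases "i = j")
  case False
  have neq: "q j \<noteq> q i" using inj_on_eq_iff[OF inj_on_q assms] False by metis
  note c = q_closed[OF assms(1)] q_closed[OF assms(2)]
  have "set_hmult H (hgen H (q j)) {q i} = set_hmult H {q i} (hgen H (q j))"
    using hprod_omit_hgen(3)[OF assms(2)] c by (auto simp: normal_closed_def)
  then have eq: "insert (q i) (hmult H (q j) (q i)) = insert (q i) (hmult H (q i) (q j))"
    using c assms by (simp add: hgen_q set_hmult_def)
  have "q j \<notin> hmult H (q i) (q i)"
    using hmult_involution[OF involution_q[OF assms(1)]] neq q_neq_hunit[OF assms(2)] by auto
  then have "q i \<notin> hmult H (q i) (q j)" "q i \<notin> hmult H (q j) (q i)"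
    using exchange_left[of "q i" "q i" "q j"] exchange_right[of "q i" "q j" "q i"]
      hstar_involution[OF involution_q[OF assms(1)]] c by auto
  then show ?thesis using eq by (simp add: insert_ident)
qed simp

lemma mem_carrier_component:
  assumes "a \<in> carrier H"
  shows "\<exists>S\<subseteq>{1..p}. hprod H (\<lambda>i. {component S i}) [1..<Suc p] = {a}"
proof -
  \<comment> \<open>Directness presents the carrier as one factor times the product of the others.
    For the first factor this is the full product in its original order.\<close>
  have p: "1 \<in> {1..p}"
    using elementary_abelian
    by (auto simp: elementary_abelian_2_hypergroup_def constrained_direct_product_def
        direct_product_def)
  then have l: "[1..<Suc p] = 1 # [2..<Suc p]"
    using upt_conv_Cons[of 1 "Suc p"] by (simp add: numeral_2_eq_2)
  have "filter (\<lambda>j. j \<noteq> 1) [1..<Suc p] = [2..<Suc p]" unfolding l by simp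
  then have "a \<in> hprod H (\<lambda>i. hgen H (q i)) [1..<Suc p]"
    using hprod_omit_hgen(2)[OF p] assms unfolding hprod_omit_def l by simp
  then obtain r where r: "\<forall>i\<in>set [1..<Suc p]. r i \<in> hgen H (q i)"
      "a \<in> hprod H (\<lambda>i. {r i}) [1..<Suc p]"
    using mem_hprod_iff[of "[1..<Suc p]" a H "\<lambda>i. hgen H (q i)"] by auto
  have eq: "hprod H (\<lambda>i. {r i}) [1..<Suc p] = {a}"
    using elementary_abelian r assms
    unfolding elementary_abelian_2_hypergroup_def constrained_direct_product_def
    by (metis (no_types, lifting) atLeastLessThanSuc_atLeastAtMost set_upt)
  have "r i = component {i\<in>{1..p}. r i = q i} i" if "i \<in> {1..p}" for i
    using r(1) hgen_q[OF that] that by (auto simp: component_def)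
  then have "hprod H (\<lambda>i. {component {i\<in>{1..p}. r i = q i} i}) [1..<Suc p] = {a}"
    unfolding eq[symmetric] by (intro hprod_cong) auto
  then show ?thesis by (intro exI[of _ "{i\<in>{1..p}. r i = q i}"]) auto
qed

text \<open>Constrainedness speaks of products that contain a given element; nonemptiness of
  hyperproducts supplies such an element.\<close>

lemma hprod_component:
  "hprod H (\<lambda>i. {component S i}) [1..<Suc p] = {element S}"
proof -
  let ?X = "hprod H (\<lambda>i. {component S i}) [1..<Suc p]"
  have "?X \<noteq> {}" using component_closed by (intro hprod_nonempty) auto
  then obtain a where a: "a \<in> ?X" by blast
  have "?X \<subseteq> carrier H" using component_closed by (intro hprod_closed) auto
  then have "a \<in> carrier H" using a by blast
  moreover have "\<forall>i\<in>{1..p}. component S i \<in> hgen H (q i)"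
    using hgen_q by (auto simp: component_def)
  ultimately have "?X = {a}"
    using elementary_abelian a
    unfolding elementary_abelian_2_hypergroup_def constrained_direct_product_def by blast
  then show ?thesis by (simp add: element_def)
qed

lemma element_surj: "element ` Pow {1..p} = carrier H"
proof
  show "element ` Pow {1..p} \<subseteq> carrier H"
  proof clarify
    fix S
    have "{element S} \<subseteq> carrier H"
      unfolding hprod_component[symmetric] using component_closed by (intro hprod_closed) auto
    then show "element S \<in> carrier H" by simp
  qed
  show "carrier H \<subseteq> element ` Pow {1..p}"
    using mem_carrier_component hprod_component by fastforce
qed

text \<open>A set commuting with every \<open>q i\<close> commutes with all elements, since each of
  them, as a singleton, is a product of some \<open>q i\<close> and units. Applied to
  \<open>{q i}\<close> and then to \<open>{a}\<close>, this passes from the generators to arbitrary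
  pairs.\<close>

lemma hmult_commute:
  assumes "a \<in> carrier H" "b \<in> carrier H"
  shows "hmult H a b = hmult H b a"
proof -
  have gen: "set_hmult H F {c} = set_hmult H {c} F"
    if F: "F \<subseteq> carrier H" and c: "c \<in> carrier H"
      and comm: "\<And>i. i \<in> {1..p} \<Longrightarrow> set_hmult H F {q i} = set_hmult H {q i} F" for F c
  proof -
    obtain S where S: "hprod H (\<lambda>i. {component S i}) [1..<Suc p] = {c}"
      using mem_carrier_component[OF c] by blast
    show ?thesis unfolding S[symmetric]
    proof (rule set_hmult_hprod_commute)
      fix i assume "i \<in> set [1..<Suc p]"
      then show "{component S i} \<subseteq> carrier H \<and>
        set_hmult H F {component S i} = set_hmult H {component S i} F"
        using component_closed[of i S] comm[of i] F by (auto simp: component_def)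
    qed (rule F)
  qed
  have "set_hmult H {q i} {a} = set_hmult H {a} {q i}" if i: "i \<in> {1..p}" for i
  proof (rule gen)
    show "set_hmult H {q i} {q j} = set_hmult H {q j} {q i}" if "j \<in> {1..p}" for j
      unfolding set_hmult_singleton using i that by (rule hmult_q_commute)
  qed (use i assms q_closed in blast)+
  then have "set_hmult H {a} {b} = set_hmult H {b} {a}"
    using gen[of "{a}" b] assms by simp
  then show ?thesis by simp
qed

lemma set_hmult_commute:
  assumes "F \<subseteq> carrier H" "G \<subseteq> carrier H"
  shows "set_hmult H F G = set_hmult H G F"
proof -
  have "set_hmult H F G = (\<Union>b\<in>F. \<Union>c\<in>G. hmult H c b)"
    unfolding set_hmult_def using assms by (intro SUP_cong refl hmult_commute) auto
  then show ?thesis by (auto simp: set_hmult_def)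
qed

lemma set_hmult_left_commute:
  assumes "F \<subseteq> carrier H" "G \<subseteq> carrier H" "K \<subseteq> carrier H"
  shows "set_hmult H F (set_hmult H G K) = set_hmult H G (set_hmult H F K)"
  using assms set_hmult_assoc[of F G K] set_hmult_assoc[of G F K] set_hmult_commute[of F G]
  by simp

text \<open>Commutativity permits regrouping by index, so that multiplication becomes
  coordinatewise.\<close>

lemma set_hmult_hprod:
  assumes "\<And>i. i \<in> set is \<Longrightarrow> F i \<subseteq> carrier H \<and> G i \<subseteq> carrier H"
  shows "set_hmult H (hprod H F is) (hprod H G is) = hprod H (\<lambda>i. set_hmult H (F i) (G i)) is"
  using assms
proof (induction "is")
  case Nil
  then show ?case using hunit_closed by simp
next
  case (Cons i "is")
  have c: "F i \<subseteq> carrier H" "G i \<subseteq> carrier H" "hprod H F is \<subseteq> carrier H"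
      "hprod H G is \<subseteq> carrier H"
    using Cons.prems hprod_closed[of "is"] by auto
  have "set_hmult H (hprod H F (i # is)) (hprod H G (i # is)) =
      set_hmult H (set_hmult H (F i) (G i)) (set_hmult H (hprod H F is) (hprod H G is))"
    using c by (simp add: set_hmult_assoc set_hmult_left_commute[of "hprod H F is"]
        set_hmult_closed)
  then show ?case using Cons by simp
qed

lemma hprod_remove:
  assumes "\<And>j. j \<in> set is \<Longrightarrow> F j \<subseteq> carrier H" "distinct is" "i \<in> set is"
  shows "hprod H F is = set_hmult H (F i) (hprod H F (filter (\<lambda>j. j \<noteq> i) is))"
  using assms
proof (induction "is")
  case (Cons k "is")
  show ?case
  proof (cases "k = i")
    case True
    then have "filter (\<lambda>j. j \<noteq> i) is = is" using Cons.prems by (auto simp: filter_id_conv)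
    then show ?thesis using True by simp
  next
    case False
    have "hprod H F (filter (\<lambda>j. j \<noteq> i) is) \<subseteq> carrier H"
      using Cons.prems by (intro hprod_closed) auto
    then show ?thesis using False Cons by (simp add: set_hmult_left_commute)
  qed
qed simp

lemma hmult_element_eq_hprod:
  "hmult H (element S) (element T) =
     hprod H (\<lambda>i. hmult H (component S i) (component T i)) [1..<Suc p]"
  using set_hmult_hprod[of "[1..<Suc p]" "\<lambda>i. {component S i}" "\<lambda>i. {component T i}"]
    component_closed unfolding hprod_component by auto

lemma hmult_component:
  assumes "i \<in> {1..p}"
  shows "hmult H (component S i) (component T i) =
    (if i \<in> symdiff S T then {q i}
     else if i \<in> S \<inter> T \<inter> thick_indices then {hunit H, q i} else {hunit H})"
  using assms q_closed[OF assms] hunit_closed hmult_involution[OF involution_q[OF assms]]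
  by (auto simp: component_def symdiff_def thick_indices_def)

text \<open>In coordinate \<open>i\<close> the product is forced to be \<open>q i\<close> on the
  symmetric difference, free between the unit and \<open>q i\<close> at a common thick index, and
  the unit elsewhere. The sets \<open>U\<close> are the possible outcomes of these choices.\<close>

lemma hmult_element:
  assumes "S \<subseteq> {1..p}" "T \<subseteq> {1..p}"
  shows "hmult H (element S) (element T) = element `
    {U. symdiff S T \<subseteq> U \<and> U \<subseteq> symdiff S T \<union> (S \<inter> T \<inter> thick_indices)}"
    (is "_ = element ` ?I")
proof -
  let ?D = "\<lambda>i. hmult H (component S i) (component T i)"
  have "a \<in> hprod H ?D [1..<Suc p] \<longleftrightarrow> a \<in> element ` ?I" for a
  proof
    assume "a \<in> hprod H ?D [1..<Suc p]"
    then obtain r where r: "\<forall>i\<in>set [1..<Suc p]. r i \<in> ?D i"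
        "a \<in> hprod H (\<lambda>i. {r i}) [1..<Suc p]"
      using mem_hprod_iff[of "[1..<Suc p]" a H ?D] by auto
    define U where "U = {i\<in>{1..p}. r i = q i}"
    have r': "r i \<in> ?D i" if "i \<in> {1..p}" for i using that r(1) by auto
    have "r i = component U i" if "i \<in> {1..p}" for i
      using r'[OF that] that hmult_component[OF that, of S T]
      by (auto simp: U_def component_def split: if_splits)
    then have "hprod H (\<lambda>i. {r i}) [1..<Suc p] = hprod H (\<lambda>i. {component U i}) [1..<Suc p]"
      by (intro hprod_cong) auto
    then have "a = element U" using r(2) hprod_component by simp
    moreover have "i \<in> U" if "i \<in> symdiff S T" for i
    proof -
      have i: "i \<in> {1..p}" using that assms by (auto simp: symdiff_def)
      then show ?thesis using r'[OF i] hmult_component[OF i, of S T] that by (simp add: U_def)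
    qed
    moreover have "i \<in> symdiff S T \<union> (S \<inter> T \<inter> thick_indices)" if "i \<in> U" for i
    proof -
      \<comment> \<open>As \<open>q i\<close> is not the unit, the value \<open>q i\<close> can be
        chosen only in a coordinate that admits it.\<close>
      have i: "i \<in> {1..p}" "r i = q i" using that by (auto simp: U_def)
      then show ?thesis
        using r'[OF i(1)] hmult_component[OF i(1), of S T] q_neq_hunit[OF i(1)]
        by (auto split: if_splits)
    qed
    ultimately show "a \<in> element ` ?I" by blast
  next
    assume "a \<in> element ` ?I"
    then obtain U where U: "U \<in> ?I" and a: "a = element U" by blast
    have "component U i \<in> ?D i" if "i \<in> {1..p}" for i
      using U unfolding hmult_component[OF that] by (auto simp: component_def)
    then have "hprod H (\<lambda>i. {component U i}) [1..<Suc p] \<subseteq> hprod H ?D [1..<Suc p]"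
      by (intro hprod_mono) auto
    then show "a \<in> hprod H ?D [1..<Suc p]" using a hprod_component by simp
  qed
  then show ?thesis unfolding hmult_element_eq_hprod by blast
qed

lemma hunit_mem_hmult_self: "hunit H \<in> hmult H (element S) (element S)"
  unfolding hmult_element_eq_hprod
  by (rule hunit_mem_hprod) (auto simp: hmult_component symdiff_def)

text \<open>The square of every element contains the unit, and exchange then places \<open>a\<close>
  in the product of its star with the unit.\<close>

lemma hstar_id:
  assumes "a \<in> carrier H"
  shows "hstar H a = a"
proof -
  obtain S where "a = element S" using assms element_surj by blast
  then have "hunit H \<in> hmult H a a" using hunit_mem_hmult_self by simp
  then have "a \<in> hmult H (hstar H a) (hunit H)"
    using exchange_left[of "hunit H" a a] assms hunit_closed by simp
  then show ?thesis using assms hstar_closed by simp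
qed

text \<open>The unit lies in the square of the common element. If \<open>i\<close> were in the
  symmetric difference, coordinate \<open>i\<close> would contribute \<open>q i\<close>, and the
  unit would lie in the product of \<open>q i\<close> with some \<open>b\<close> built from the
  other factors. Exchange forces \<open>b = q i\<close>, contrary to directness.\<close>

lemma element_eqD:
  assumes "element S = element T" "i \<in> {1..p}"
  shows "i \<notin> symdiff S T"
proof
  assume i: "i \<in> symdiff S T"
  let ?D = "\<lambda>i. hmult H (component S i) (component T i)"
  let ?L = "filter (\<lambda>j. j \<noteq> i) [1..<Suc p]"
  have D: "?D j \<subseteq> carrier H" if "j \<in> {1..p}" for j
    using that component_closed hmult_closed by blast
  have "hunit H \<in> hprod H ?D [1..<Suc p]"
    using hunit_mem_hmult_self[of S] assms(1) hmult_element_eq_hprod[of S T] by simp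
  also have "\<dots> = set_hmult H (?D i) (hprod H ?D ?L)"
    using D assms(2) by (intro hprod_remove) auto
  finally obtain b where b: "b \<in> hprod H ?D ?L" "hunit H \<in> hmult H (q i) b"
    using i hmult_component[OF assms(2), of S T] by (auto simp: set_hmult_def)
  have "hprod H ?D ?L \<subseteq> hprod_omit H p (\<lambda>i. hgen H (q i)) i"
    unfolding hprod_omit_def by (rule hprod_mono) (auto simp: hmult_component hgen_q)
  then have b': "b \<in> hprod_omit H p (\<lambda>i. hgen H (q i)) i" using b by blast
  have "hprod H ?D ?L \<subseteq> carrier H" using D by (intro hprod_closed) auto
  then have "b \<in> carrier H" using b by blast
  then have "b \<in> hmult H (hstar H (q i)) (hunit H)"
    using exchange_left[of "hunit H" "q i" b] b(2) q_closed[OF assms(2)] hunit_closed by simp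
  then have "b = q i" using q_closed[OF assms(2)] hstar_id by simp
  then show False using b' q_not_mem_hprod_omit[OF assms(2)] by simp
qed

lemma bij_betw_element: "bij_betw element (Pow {1..p}) (carrier H)"
  unfolding bij_betw_def
proof
  show "inj_on element (Pow {1..p})"
    using element_eqD by (fastforce simp: inj_on_def symdiff_def)
qed (rule element_surj)

lemma element_mem_image_iff:
  assumes "\<Phi> \<subseteq> Pow {1..p}" "U \<subseteq> {1..p}"
  shows "element U \<in> element ` \<Phi> \<longleftrightarrow> U \<in> \<Phi>"
  using bij_betw_imp_inj_on[OF bij_betw_element] assms by (intro inj_on_image_mem_iff) auto

section \<open>Closed and strongly normal closed subsets as families of index sets\<close>

lemma closed_subset_iff:
  "closed_subset H F \<longleftrightarrow> F \<noteq> {} \<and> F \<subseteq> carrier H \<and> set_hmult H F F \<subseteq> F"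
proof -
  have "hstar H ` F = F" if "F \<subseteq> carrier H" using that hstar_id by (force simp: image_def)
  then show ?thesis by (auto simp: closed_subset_def)
qed

lemma closed_subset_element_image_iff:
  assumes "\<Phi> \<subseteq> Pow {1..p}"
  shows "closed_subset H (element ` \<Phi>) \<longleftrightarrow> closed_family thick_indices \<Phi>"
proof -
  let ?I = "\<lambda>S T. {U. symdiff S T \<subseteq> U \<and> U \<subseteq> symdiff S T \<union> (S \<inter> T \<inter> thick_indices)}"
  have sub: "element ` \<Phi> \<subseteq> carrier H" using assms element_surj by blast
  have "set_hmult H (element ` \<Phi>) (element ` \<Phi>) \<subseteq> element ` \<Phi> \<longleftrightarrow>
      (\<forall>S\<in>\<Phi>. \<forall>T\<in>\<Phi>. hmult H (element S) (element T) \<subseteq> element ` \<Phi>)"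
    by (auto simp: set_hmult_def)
  also have "\<dots> \<longleftrightarrow> (\<forall>S\<in>\<Phi>. \<forall>T\<in>\<Phi>. ?I S T \<subseteq> \<Phi>)"
  proof (intro ball_cong refl)
    fix S T assume "S \<in> \<Phi>" "T \<in> \<Phi>"
    then have ST: "S \<subseteq> {1..p}" "T \<subseteq> {1..p}" using assms by auto
    \<comment> \<open>Membership in the image reflects membership in \<open>\<Phi>\<close> only for
      index sets within \<open>{1..p}\<close>, where \<open>element\<close> is injective.\<close>
    then have "U \<subseteq> {1..p}" if "U \<in> ?I S T" for U using that by (auto simp: symdiff_def)
    then show "hmult H (element S) (element T) \<subseteq> element ` \<Phi> \<longleftrightarrow> ?I S T \<subseteq> \<Phi>"
      unfolding hmult_element[OF ST] image_subset_iff subset_eq[of "?I S T"]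
      by (intro ball_cong refl element_mem_image_iff[OF assms])
  qed
  also have "\<dots> \<longleftrightarrow> (\<forall>S\<in>\<Phi>. \<forall>T\<in>\<Phi>. \<forall>U. symdiff S T \<subseteq> U \<and>
      U \<subseteq> symdiff S T \<union> (S \<inter> T \<inter> thick_indices) \<longrightarrow> U \<in> \<Phi>)"
    by (simp only: subset_iff[of "?I _ _"] mem_Collect_eq)
  finally show ?thesis
    using sub by (simp only: closed_subset_iff closed_family_def image_is_empty simp_thms)
qed

text \<open>By commutativity, conjugating by \<open>a\<close> means multiplying by the square of
  \<open>a\<close>. Strong normality thus asks that a closed subset absorb all squares, and the
  square of \<open>element S\<close> consists of the subsets of
  \<open>S \<inter> thick_indices\<close>.\<close>

lemma strongly_normal_closed_element_image_iff:
  assumes "\<Phi> \<subseteq> Pow {1..p}"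
  shows "strongly_normal_closed H (element ` \<Phi>) (carrier H) \<longleftrightarrow>
    closed_family thick_indices \<Phi> \<and> thick_indices \<in> \<Phi>"
proof -
  let ?F = "element ` \<Phi>"
  have tsub: "thick_indices \<subseteq> {1..p}" by (auto simp: thick_indices_def)
  have carr: "closed_subset H (carrier H)"
    unfolding closed_subset_iff using nonempty set_hmult_closed by auto
  have sub: "?F \<subseteq> carrier H" using assms element_surj by blast
  have conj: "set_hmult H (set_hmult H {a} ?F) {a} = set_hmult H ?F (hmult H a a)"
    if "a \<in> carrier H" for a
    using that sub set_hmult_commute[of "{a}" ?F] set_hmult_assoc[of ?F "{a}" "{a}"] by simp
  have square: "hmult H (element S) (element S) = element ` Pow (S \<inter> thick_indices)"
    if "S \<subseteq> {1..p}" for S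
  proof -
    have "symdiff S S = {}" by (simp add: symdiff_def)
    then show ?thesis using hmult_element[OF that that] by (simp add: Pow_def)
  qed
  show ?thesis
  proof
    assume sn: "strongly_normal_closed H ?F (carrier H)"
    then have cl: "closed_subset H ?F" by (simp add: strongly_normal_closed_def)
    \<comment> \<open>The product of all thick \<open>q i\<close> is chosen because its square
      contains the element itself.\<close>
    let ?a = "element thick_indices"
    have a: "?a \<in> carrier H" using tsub element_surj by blast
    have "set_hmult H (set_hmult H {?a} ?F) {?a} \<subseteq> ?F"
      using sn a hstar_id unfolding strongly_normal_closed_def by metis
    then have *: "set_hmult H ?F (hmult H ?a ?a) \<subseteq> ?F" using conj[OF a] by simp
    have "set_hmult H {hunit H} (hmult H ?a ?a) \<subseteq> set_hmult H ?F (hmult H ?a ?a)"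
      using hunit_mem_closed_subset[OF cl] by (intro set_hmult_mono) auto
    then have "hmult H ?a ?a \<subseteq> ?F" using * a hmult_closed[of ?a ?a] by simp
    then have "?a \<in> ?F" using square[OF tsub] by auto
    then show "closed_family thick_indices \<Phi> \<and> thick_indices \<in> \<Phi>"
      using cl closed_subset_element_image_iff[OF assms] element_mem_image_iff[OF assms tsub]
      by simp
  next
    assume *: "closed_family thick_indices \<Phi> \<and> thick_indices \<in> \<Phi>"
    then have cl: "closed_subset H ?F" using closed_subset_element_image_iff[OF assms] by simp
    have "set_hmult H (set_hmult H {hstar H a} ?F) {a} \<subseteq> ?F" if a: "a \<in> carrier H" for a
    proof -
      obtain S where S: "S \<subseteq> {1..p}" "a = element S" using a element_surj by blast
      \<comment> \<open>Closedness passes from the member \<open>thick_indices\<close> to all its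
        subsets, hence to every square.\<close>
      have "Pow (S \<inter> thick_indices) \<subseteq> \<Phi>"
        using * closed_family_subset[of thick_indices \<Phi> thick_indices] by blast
      then have "hmult H a a \<subseteq> ?F" using square S by auto
      then have "set_hmult H ?F (hmult H a a) \<subseteq> set_hmult H ?F ?F" by (intro set_hmult_mono) auto
      also have "\<dots> \<subseteq> ?F" using cl by (simp add: closed_subset_iff)
      finally show ?thesis using conj[OF a] hstar_id[OF a] by simp
    qed
    then show "strongly_normal_closed H ?F (carrier H)"
      using cl carr sub by (simp add: strongly_normal_closed_def)
  qed
qed

text \<open>Taking images under the bijection \<open>element\<close> transports either count to
  families of index sets; \<open>P\<close> and \<open>Q\<close> stand for the property on the two
  sides.\<close>

lemma card_families_eq:
  assumes "\<And>F. P F \<Longrightarrow> F \<subseteq> carrier H"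
    and "\<And>\<Phi>. \<Phi> \<subseteq> Pow {1..p} \<Longrightarrow> P (element ` \<Phi>) \<longleftrightarrow> Q \<Phi>"
  shows "card {F. P F} = card {\<Phi>. \<Phi> \<subseteq> Pow {1..p} \<and> Q \<Phi>}"
proof -
  have "inj_on ((`) element) (Pow (Pow {1..p}))"
    by (rule inj_on_image_Pow[OF bij_betw_imp_inj_on[OF bij_betw_element]])
  then have "inj_on ((`) element) {\<Phi>. \<Phi> \<subseteq> Pow {1..p} \<and> Q \<Phi>}"
    by (rule inj_on_subset) auto
  then have "card ((`) element ` {\<Phi>. \<Phi> \<subseteq> Pow {1..p} \<and> Q \<Phi>}) =
      card {\<Phi>. \<Phi> \<subseteq> Pow {1..p} \<and> Q \<Phi>}" by (rule card_image)
  moreover have "(`) element ` {\<Phi>. \<Phi> \<subseteq> Pow {1..p} \<and> Q \<Phi>} = {F. P F}"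
  proof (intro equalityI subsetI)
    fix F assume "F \<in> {F. P F}"
    then have F: "P F" by simp
    then have "F \<subseteq> element ` Pow {1..p}" using assms(1) element_surj by simp
    then obtain \<Phi> where \<Phi>: "\<Phi> \<subseteq> Pow {1..p}" "F = element ` \<Phi>" by (rule subset_imageE)
    then have "Q \<Phi>" using F assms(2) by simp
    then show "F \<in> (`) element ` {\<Phi>. \<Phi> \<subseteq> Pow {1..p} \<and> Q \<Phi>}" using \<Phi> by simp
  qed (use assms(2) in auto)
  ultimately show ?thesis by simp
qed

text \<open>The theorem counts thick elements, the argument counts thick indices; injectivity of
  \<open>q\<close> makes the two numbers agree.\<close>

lemma card_thick_indices: "card thick_indices = card {a \<in> q ` {1..p}. thick H a}"
proof -
  have "{a \<in> q ` {1..p}. thick H a} = q ` thick_indices" by (auto simp: thick_indices_def)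
  moreover have "inj_on q thick_indices"
    using inj_on_q by (rule inj_on_subset) (auto simp: thick_indices_def)
  ultimately show ?thesis by (simp add: card_image)
qed

end

theorem theorem3p14:
  fixes H :: "('a, 'b) hypergroup_scheme"
    and q :: "nat \<Rightarrow> 'a"
    and p p_thick :: nat
  assumes "elementary_abelian_2_hypergroup H p q"
    and "p_thick = card {a \<in> q ` {1..p}. thick H a}"
  shows "card {F. closed_subset H F} =
           2 ^ p_thick * (\<Sum>r=0..p - p_thick. gauss_coeff_2 (p - p_thick) r) \<and>
         card {F. strongly_normal_closed H F (carrier H)} =
           (\<Sum>r=0..p - p_thick. gauss_coeff_2 (p - p_thick) r)"
proof -
  interpret elementary_abelian_2 H p q
    using assms(1)
    by (simp add: elementary_abelian_2_def elementary_abelian_2_axioms_def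
        elementary_abelian_2_hypergroup_def)
  have sub: "thick_indices \<subseteq> {1..p}" by (auto simp: thick_indices_def)
  have thick: "card thick_indices = p_thick" using assms(2) card_thick_indices by simp
  \<comment> \<open>The thick indices form a subset of \<open>{1..p}\<close>, so the difference of
    natural numbers is not truncated and counts the thin indices.\<close>
  have thin: "card ({1..p} - thick_indices) = p - p_thick"
    using sub thick by (simp add: card_Diff_subset finite_subset)
  have "card {F. closed_subset H F} =
      card {\<Phi>. \<Phi> \<subseteq> Pow {1..p} \<and> closed_family thick_indices \<Phi>}"
    using closed_subset_element_image_iff
    by (intro card_families_eq) (auto simp: closed_subset_def)
  moreover have "card {F. strongly_normal_closed H F (carrier H)} =
      card {\<Phi>. \<Phi> \<subseteq> Pow {1..p} \<and> closed_family thick_indices \<Phi> \<and> thick_indices \<in> \<Phi>}"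
    using strongly_normal_closed_element_image_iff
    by (intro card_families_eq) (auto simp: strongly_normal_closed_def)
  ultimately show ?thesis
    using card_closed_families[OF _ sub, unfolded thick thin]
      card_closed_families_containing[OF _ sub, unfolded thick thin] by simp
qed

end
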